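(* Let $X$ be an infinite-dimensional reflexive Banach space (real or complex). Then for some $\varepsilon>0$ the unit sphere of $X$ contains a symmetrically $(1+\varepsilon)$-separated sequence.
   Context: For $\delta>0$, a sequence $(x_n)$ in a normed space is symmetrically $\delta$-separated if $\|x_n\pm x_k\|\ge\delta$ (both signs) for all $n\neq k$. *)

theory Defs
  imports "HOL-Analysis.Analysis"
begin

text \<open>
  Normed spaces over a normed field \<open>'k\<close>, to be used with \<open>'k = real\<close> and \<open>'k = complex\<close>.
  The real scalar multiplication of the type class is the restriction of \<open>scale\<close> to real
  scalars, so norm, topology and completeness come from the type class.
\<close>

locale normed_space_over = vector_space scale
  for scale :: "'k::real_normed_field \<Rightarrow> 'a::real_normed_vector \<Rightarrow> 'a" +
  assumes scale_of_real: "scale (of_real r) x = r *\<^sub>R x"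
    and norm_scale: "norm (scale c x) = norm c * norm x"
begin

definition infinite_dimensional :: bool where
  "infinite_dimensional \<longleftrightarrow> \<not> (\<exists>B. finite B \<and> span B = UNIV)"

definition dual :: "('a \<Rightarrow> 'k) set" where
  "dual = {f. Vector_Spaces.linear scale (*) f \<and> bounded_linear f}"

text \<open>
  Linear functionals on \<^term>\<open>dual\<close> that are bounded for the operator norm \<^const>\<open>onorm\<close>.
  Their values outside \<^term>\<open>dual\<close> are unconstrained and carry no meaning.
\<close>

definition bidual :: "(('a \<Rightarrow> 'k) \<Rightarrow> 'k) set" where
  "bidual = {\<Phi>.
     (\<forall>f\<in>dual. \<forall>g\<in>dual. \<Phi> (\<lambda>x. f x + g x) = \<Phi> f + \<Phi> g) \<and>
     (\<forall>c. \<forall>f\<in>dual. \<Phi> (\<lambda>x. c * f x) = c * \<Phi> f) \<and>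
     (\<exists>C. \<forall>f\<in>dual. norm (\<Phi> f) \<le> C * onorm f)}"

text \<open>Surjectivity of the canonical embedding of the space into its bidual.\<close>

definition reflexive :: bool where
  "reflexive \<longleftrightarrow> (\<forall>\<Phi>\<in>bidual. \<exists>x. \<forall>f\<in>dual. \<Phi> f = f x)"

end

lemma normed_space_over_real:
  "normed_space_over (scaleR :: real \<Rightarrow> 'a::real_normed_vector \<Rightarrow> 'a)"
  by unfold_locales (auto simp: algebra_simps)

lemma normed_space_over_complex:
  "normed_space_over ((*) :: complex \<Rightarrow> complex \<Rightarrow> complex)"
  by unfold_locales (auto simp: algebra_simps norm_mult scaleR_conv_of_real)

definition symmetrically_separated :: "real \<Rightarrow> (nat \<Rightarrow> 'a::real_normed_vector) \<Rightarrow> bool" where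
  "symmetrically_separated \<delta> x \<longleftrightarrow>
     (\<forall>n k. n \<noteq> k \<longrightarrow> norm (x n + x k) \<ge> \<delta> \<and> norm (x n - x k) \<ge> \<delta>)"

end

theory Submission
  imports Defs
begin

text \<open>
  A space that is reflexive over \<open>\<complex>\<close> is reflexive over \<open>\<real>\<close>, so real scalars suffice. Suppose that no
  sequence in the sphere is symmetrically \<open>(1 + \<epsilon>)\<close>-separated, for any \<open>\<epsilon> > 0\<close>. Then every subspace
  \<open>Z\<close> of finite codimension has a finite set \<open>F\<close> of unit vectors such that every unit vector \<open>v\<close> of
  \<open>Z\<close> satisfies \<open>norm (x + v) < 1 + \<epsilon>\<close> for some \<open>x \<in> F\<close>. Apply this with \<open>\<epsilon> = 1/2, 1/4, \<dots>\<close> to a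
  decreasing sequence \<open>Z n\<close>, where \<open>Z n\<close> is almost orthogonal to the span of \<open>F 0 \<union> \<dots> \<union> F (n - 1)\<close> in the sense
  of Mazur. Choosing vectors backwards from \<open>N\<close> to \<open>0\<close> gives \<open>x i \<in> F i\<close> with
  \<open>norm (x 0 + \<dots> + x (N - 1)) \<le> 2\<close>, and Koenig's lemma an infinite sequence of unit vectors with bounded
  partial sums \<open>s n\<close>. By reflexivity these have a weak cluster point \<open>a\<close>. It lies in the closed
  span of the \<open>x i\<close>, and \<open>a - s n \<in> Z n\<close>; almost orthogonality then forces \<open>s n\<close> to be eventually
  close to a single vector, which contradicts \<open>norm (s (n + 1) - s n) = 1\<close>.
\<close>

section \<open>Sublinear functionals and the Hahn-Banach theorem\<close>

text \<open>Only one inequality for positive scalars is demanded, which is all that has to be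
  checked for a new functional. Applying it to \<open>t\<close> and to \<open>inverse t\<close>
  gives back full positive homogeneity, see \<open>sublinear_scaleR\<close>.\<close>

definition sublinear :: "('a::real_vector \<Rightarrow> real) \<Rightarrow> bool" where
  "sublinear p \<longleftrightarrow> (\<forall>x y. p (x + y) \<le> p x + p y) \<and> (\<forall>t>0. \<forall>x. p (t *\<^sub>R x) \<le> t * p x)"

lemma sublinearI:
  assumes "\<And>x y. p (x + y) \<le> p x + p y" "\<And>t x. t > 0 \<Longrightarrow> p (t *\<^sub>R x) \<le> t * p x"
  shows "sublinear p"
  using assms by (simp add: sublinear_def)

lemma sublinear_add: "sublinear p \<Longrightarrow> p (x + y) \<le> p x + p y"
  by (simp add: sublinear_def)

lemma sublinear_zero:
  assumes "sublinear p" shows "p 0 = 0"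
proof -
  have "p ((1/2) *\<^sub>R 0) \<le> (1/2) * p 0"
    using assms unfolding sublinear_def by (metis half_gt_zero_iff zero_less_one)
  moreover have "p (0 + 0) \<le> p 0 + p 0"
    using assms by (rule sublinear_add)
  ultimately show ?thesis by simp
qed

lemma sublinear_scaleR:
  assumes "sublinear p" "t \<ge> 0" shows "p (t *\<^sub>R x) = t * p x"
proof (cases "t = 0")
  case True
  then show ?thesis using sublinear_zero[OF assms(1)] by simp
next
  case False
  with assms have t: "t > 0" by simp
  have "p (inverse t *\<^sub>R (t *\<^sub>R x)) \<le> inverse t * p (t *\<^sub>R x)"
    using assms t unfolding sublinear_def by (meson inverse_positive_iff_positive)
  then have "p x \<le> inverse t * p (t *\<^sub>R x)"
    using t by simp
  then have "t * p x \<le> p (t *\<^sub>R x)"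
    using t by (simp add: field_simps)
  moreover have "p (t *\<^sub>R x) \<le> t * p x"
    using assms t by (simp add: sublinear_def)
  ultimately show ?thesis by simp
qed

lemma sublinear_minus_le:
  assumes "sublinear p" shows "- p (- x) \<le> p x"
  using sublinear_add[OF assms, of x "-x"] sublinear_zero[OF assms] by simp

text \<open>Subadditivity is where the chain matters: near-optimal \<open>q\<close> for
  \<open>x\<close> and \<open>r\<close> for \<open>y\<close> can both be replaced by the smaller of
  the two.\<close>

lemma sublinear_INF_chain:
  assumes ne: "C \<noteq> {}" and sub: "\<And>q. q \<in> C \<Longrightarrow> sublinear q"
    and chain: "\<And>q r. q \<in> C \<Longrightarrow> r \<in> C \<Longrightarrow> q \<le> r \<or> r \<le> q"
    and bdd: "\<And>x. bdd_below ((\<lambda>q. q x) ` C)"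
  shows "sublinear (\<lambda>x. INF q\<in>C. q x)"
proof (rule sublinearI)
  fix x y
  have le: "(INF q\<in>C. q (x + y)) \<le> q x + r y" if qr: "q \<in> C" "r \<in> C" for q r
  proof -
    obtain u where u: "u \<in> C" "u x \<le> q x" "u y \<le> r y"
      using chain[OF qr] qr by (auto simp: le_fun_def)
    have "(INF q\<in>C. q (x + y)) \<le> u (x + y)"
      by (rule cINF_lower[OF bdd u(1)])
    also have "\<dots> \<le> u x + u y"
      by (rule sublinear_add[OF sub[OF u(1)]])
    finally show ?thesis using u by linarith
  qed
  have "(INF q\<in>C. q (x + y)) - (INF q\<in>C. q x) \<le> r y" if "r \<in> C" for r
  proof -
    have "(INF q\<in>C. q (x + y)) - r y \<le> (INF q\<in>C. q x)"
      using le[OF _ that] by (intro cINF_greatest[OF ne]) (simp add: algebra_simps)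
    then show ?thesis by linarith
  qed
  then have "(INF q\<in>C. q (x + y)) - (INF q\<in>C. q x) \<le> (INF q\<in>C. q y)"
    by (intro cINF_greatest[OF ne])
  then show "(INF q\<in>C. q (x + y)) \<le> (INF q\<in>C. q x) + (INF q\<in>C. q y)"
    by linarith
next
  fix t :: real and x
  assume t: "t > 0"
  have "(INF q\<in>C. q (t *\<^sub>R x)) / t \<le> q x" if "q \<in> C" for q
  proof -
    have "(INF q\<in>C. q (t *\<^sub>R x)) \<le> t * q x"
      using cINF_lower[OF bdd that, of "t *\<^sub>R x"] sublinear_scaleR[OF sub[OF that], of t x] t by simp
    then show ?thesis using t by (simp add: field_simps)
  qed
  then have "(INF q\<in>C. q (t *\<^sub>R x)) / t \<le> (INF q\<in>C. q x)"
    by (intro cINF_greatest[OF ne])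
  then show "(INF q\<in>C. q (t *\<^sub>R x)) \<le> t * (INF q\<in>C. q x)"
    using t by (simp add: field_simps)
qed

text \<open>The way to push a sublinear functional down in a prescribed direction. It serves twice
  in \<open>hahn_banach\<close>: the bound at \<open>- y\<close> secures the value at
  \<open>x0\<close>, and the last bound turns minimality into superadditivity.\<close>

lemma sublinear_lower:
  assumes p: "sublinear p"
  obtains q where "sublinear q" "q \<le> p" "q (- y) \<le> - p y"
    "\<And>x. q x \<le> p (x + y) - p y"
proof -
  define q where "q x = (INF t\<in>{0..}. p (x + t *\<^sub>R y) - t * p y)" for x
  \<comment> \<open>Finiteness of the infimum: split \<open>t *\<^sub>R y\<close> as
    \<open>x + t *\<^sub>R y\<close> plus \<open>- x\<close> and use homogeneity at
    \<open>y\<close>.\<close>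
  have bdd: "bdd_below ((\<lambda>t. p (x + t *\<^sub>R y) - t * p y) ` {0..})" for x
  proof (rule bdd_belowI2)
    fix t :: real assume t: "t \<in> {0..}"
    have "p (t *\<^sub>R y) \<le> p (x + t *\<^sub>R y) + p (- x)"
      using sublinear_add[OF p, of "x + t *\<^sub>R y" "-x"] by simp
    then show "- p (- x) \<le> p (x + t *\<^sub>R y) - t * p y"
      using sublinear_scaleR[OF p, of t y] t by simp
  qed
  have q_le: "q x \<le> p (x + t *\<^sub>R y) - t * p y" if "t \<ge> 0" for t x
    unfolding q_def using cINF_lower[OF bdd, of t x] that by simp
  have q_ge: "c \<le> q x" if "\<And>t. t \<ge> 0 \<Longrightarrow> c \<le> p (x + t *\<^sub>R y) - t * p y" for c x
    unfolding q_def by (rule cINF_greatest) (use that in auto)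
  have "sublinear q"
  proof (rule sublinearI)
    fix u v
    have *: "q (u + v) \<le> (p (u + s *\<^sub>R y) - s * p y) + (p (v + t *\<^sub>R y) - t * p y)"
      if "s \<ge> 0" "t \<ge> 0" for s t
      using q_le[of "s + t" "u + v"] that sublinear_add[OF p, of "u + s *\<^sub>R y" "v + t *\<^sub>R y"]
      by (simp add: algebra_simps)
    have "q (u + v) - (p (v + t *\<^sub>R y) - t * p y) \<le> q u" if "t \<ge> 0" for t
    proof (rule q_ge)
      fix s :: real assume "s \<ge> 0"
      show "q (u + v) - (p (v + t *\<^sub>R y) - t * p y) \<le> p (u + s *\<^sub>R y) - s * p y"
        using *[OF \<open>s \<ge> 0\<close> that] by linarith
    qed
    then have "q (u + v) - q u \<le> p (v + t *\<^sub>R y) - t * p y" if "t \<ge> 0" for t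
      using that by fastforce
    then have "q (u + v) - q u \<le> q v"
      by (rule q_ge)
    then show "q (u + v) \<le> q u + q v" by linarith
  next
    fix s :: real and x assume s: "s > 0"
    have "q (s *\<^sub>R x) / s \<le> q x"
    proof (rule q_ge)
      fix t :: real assume t: "t \<ge> 0"
      have "q (s *\<^sub>R x) \<le> p (s *\<^sub>R (x + t *\<^sub>R y)) - s * t * p y"
        using q_le[of "s * t" "s *\<^sub>R x"] s t by (simp add: algebra_simps)
      also have "\<dots> = s * (p (x + t *\<^sub>R y) - t * p y)"
        using sublinear_scaleR[OF p, of s "x + t *\<^sub>R y"] s by (simp add: algebra_simps)
      finally show "q (s *\<^sub>R x) / s \<le> p (x + t *\<^sub>R y) - t * p y"
        using s by (simp add: field_simps)
    qed
    then show "q (s *\<^sub>R x) \<le> s * q x" using s by (simp add: field_simps)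
  qed
  moreover have "q \<le> p"
    using q_le[of 0] by (simp add: le_fun_def)
  moreover have "q (- y) \<le> - p y"
    using q_le[of 1 "- y"] sublinear_zero[OF p] by simp
  moreover have "q x \<le> p (x + y) - p y" for x
    using q_le[of 1 x] by simp
  ultimately show thesis using that by blast
qed

text \<open>A pointwise minimal sublinear functional is linear, and Zorn's lemma provides one.\<close>

theorem hahn_banach:
  fixes p :: "'a::real_vector \<Rightarrow> real"
  assumes "sublinear p"
  obtains g where "linear g" "\<And>x. g x \<le> p x" "g x0 = p x0"
proof -
  \<comment> \<open>Any linear \<open>g\<close> below \<open>p'\<close> has
    \<open>- g x0 \<le> - p x0\<close>, so the bound at \<open>- x0\<close> forces
    \<open>g x0 = p x0\<close> in the end.\<close>
  obtain p' where p': "sublinear p'" "p' \<le> p" "p' (- x0) \<le> - p x0"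
    using sublinear_lower[OF assms] by metis
  define A where "A = {q. sublinear q \<and> q \<le> p'}"
  \<comment> \<open>Zorn is applied to the reversed pointwise order, so that maximal means minimal
    and chains need lower bounds.\<close>
  have "\<exists>m\<in>A. \<forall>a\<in>A. a \<le> m \<longrightarrow> a = m"
  proof (rule predicate_Zorn)
    show "partial_order_on A (relation_of (\<lambda>q r. r \<le> q) A)"
      by (rule partial_order_on_relation_ofI) auto
    fix C assume "C \<in> Chains (relation_of (\<lambda>q r. r \<le> q) A)"
    then have CA: "C \<subseteq> A" and chain: "\<And>q r. q \<in> C \<Longrightarrow> r \<in> C \<Longrightarrow> q \<le> r \<or> r \<le> q"
      unfolding Chains_def relation_of_def by auto
    show "\<exists>u\<in>A. \<forall>q\<in>C. u \<le> q"
    proof (cases "C = {}")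
      case True
      then show ?thesis using p' by (auto simp: A_def)
    next
      case False
      \<comment> \<open>The bound does not depend on \<open>q\<close>: \<open>q x\<close> is at
        least \<open>- q (- x)\<close>, and \<open>q (- x)\<close> is at most
        \<open>p' (- x)\<close>.\<close>
      have bdd: "bdd_below ((\<lambda>q. q x) ` C)" for x
      proof (rule bdd_belowI2)
        fix q assume "q \<in> C"
        then have "sublinear q" "q \<le> p'" using CA by (auto simp: A_def)
        then show "- p' (- x) \<le> q x"
          using sublinear_minus_le[of q x] by (smt (verit) le_fun_def)
      qed
      define u where "u x = (INF q\<in>C. q x)" for x
      have "sublinear u"
        unfolding u_def using CA by (intro sublinear_INF_chain False chain bdd) (auto simp: A_def)
      moreover have u: "u \<le> q" if "q \<in> C" for q
        using cINF_lower[OF bdd that] by (simp add: le_fun_def u_def)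
      moreover have "u \<le> p'"
        using False u CA by (force simp: A_def intro: order_trans)
      ultimately show ?thesis by (auto simp: A_def)
    qed
  qed
  then obtain g where g: "sublinear g" "g \<le> p'"
    and min: "\<And>q. sublinear q \<Longrightarrow> q \<le> p' \<Longrightarrow> q \<le> g \<Longrightarrow> q = g"
    by (auto simp: A_def)
  \<comment> \<open>Pushing \<open>g\<close> down along \<open>y\<close> yields nothing new by
    minimality, so \<open>g\<close> satisfies \<open>g x \<le> g (x + y) - g y\<close>
    itself.\<close>
  have add: "g (x + y) = g x + g y" for x y
  proof -
    obtain q where q: "sublinear q" "q \<le> g" "\<And>x. q x \<le> g (x + y) - g y"
      using sublinear_lower[OF g(1), of y] by metis
    have "q = g" using min q g(2) by (meson order_trans)
    then show ?thesis
      using q(3)[of x] sublinear_add[OF g(1), of x y] by simp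
  qed
  have minus: "g (- x) = - g x" for x
    using add[of x "- x"] sublinear_zero[OF g(1)] by simp
  have "linear g"
  proof (rule linearI)
    fix r :: real and x
    show "g (r *\<^sub>R x) = r *\<^sub>R g x"
    proof (cases "r \<ge> 0")
      case True
      then show ?thesis using sublinear_scaleR[OF g(1)] by simp
    next
      case False
      then have "g ((- r) *\<^sub>R x) = - r * g x"
        by (intro sublinear_scaleR[OF g(1)]) simp
      then show ?thesis using minus[of "r *\<^sub>R x"] by simp
    qed
  qed (rule add)
  moreover have le: "g x \<le> p x" for x
    using g(2) p'(2) by (meson le_funD order_trans)
  moreover have "g x0 = p x0"
    using le[of x0] le_funD[OF g(2), of "- x0"] p'(3) minus[of x0] by linarith
  ultimately show thesis by (rule that)
qed

section \<open>Norming and separating functionals\<close>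

lemma bounded_linear_of_le_norm:
  fixes g :: "'a::real_normed_vector \<Rightarrow> real"
  assumes "linear g" "\<And>x. g x \<le> norm x"
  shows "bounded_linear g" "\<bar>g x\<bar> \<le> norm x"
proof -
  have *: "\<bar>g x\<bar> \<le> norm x" for x
    using assms(2)[of x] assms(2)[of "-x"] linear_neg[OF assms(1), of x] by simp
  show "bounded_linear g"
    using assms(1) * by (intro bounded_linear_intro[where K = 1]) (auto simp: linear_iff)
  show "\<bar>g x\<bar> \<le> norm x" by (rule *)
qed

lemma norming_functional:
  fixes x :: "'a::real_normed_vector"
  obtains g :: "'a \<Rightarrow> real" where "bounded_linear g" "\<And>y. \<bar>g y\<bar> \<le> norm y" "g x = norm x"
proof -
  have "sublinear (norm :: 'a \<Rightarrow> real)"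
    by (rule sublinearI) (auto intro: norm_triangle_ineq)
  then obtain g where "linear g" "\<And>y. g y \<le> norm y" "g x = norm x"
    using hahn_banach by metis
  then show thesis using bounded_linear_of_le_norm[of g] that by blast
qed

text \<open>This distance is the majorant for separation from \<open>M\<close>. Near-minimisers in
  \<open>M\<close> for \<open>x\<close> and \<open>y\<close> add up to a competitor for
  \<open>x + y\<close>, and scale to one for multiples of \<open>x\<close>.\<close>

lemma sublinear_infdist:
  fixes M :: "'a::real_normed_vector set"
  assumes "subspace M"
  shows "sublinear (\<lambda>x. infdist x M)"
proof -
  have ne: "M \<noteq> {}" using subspace_0[OF assms] by auto
  have approx: "\<exists>m\<in>M. dist x m < infdist x M + e" if "e > 0" for x e
    using cINF_less_iff[of M "dist x" "infdist x M + e"] ne that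
    by (simp add: infdist_notempty[OF ne])
  show ?thesis
  proof (rule sublinearI)
    fix x y
    show "infdist (x + y) M \<le> infdist x M + infdist y M"
    proof (rule field_le_epsilon)
      fix e :: real assume "e > 0"
      then obtain m n where mn: "m \<in> M" "dist x m < infdist x M + e/2"
          "n \<in> M" "dist y n < infdist y M + e/2"
        using approx[of "e/2"] by (meson half_gt_zero)
      have "infdist (x + y) M \<le> dist (x + y) (m + n)"
        by (rule infdist_le) (use mn assms in \<open>auto intro: subspace_add\<close>)
      also have "\<dots> \<le> dist x m + dist y n"
        by (rule dist_triangle_add)
      finally show "infdist (x + y) M \<le> infdist x M + infdist y M + e"
        using mn by linarith
    qed
  next
    fix t :: real and x assume t: "t > 0"
    show "infdist (t *\<^sub>R x) M \<le> t * infdist x M"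
    proof (rule field_le_epsilon)
      fix e :: real assume "e > 0"
      then obtain m where m: "m \<in> M" "dist x m < infdist x M + e / t"
        using approx[of "e/t"] t by (meson divide_pos_pos)
      have "infdist (t *\<^sub>R x) M \<le> dist (t *\<^sub>R x) (t *\<^sub>R m)"
        by (rule infdist_le) (use m assms in \<open>auto intro: subspace_scale\<close>)
      also have "\<dots> = t * dist x m"
        using t by (simp add: dist_norm flip: scaleR_diff_right)
      also have "\<dots> \<le> t * (infdist x M + e / t)"
        using m t by (intro mult_left_mono) auto
      finally show "infdist (t *\<^sub>R x) M \<le> t * infdist x M + e"
        using t by (simp add: algebra_simps)
    qed
  qed
qed

text \<open>Hahn-Banach below the distance to \<open>M\<close>, attaining it at \<open>x\<close>. On
  \<open>M\<close> the distance is 0, so \<open>g m\<close> and \<open>g (- m)\<close> are both at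
  most 0.\<close>

lemma separating_functional:
  fixes M :: "'a::real_normed_vector set"
  assumes "subspace M" "x \<notin> closure M"
  obtains g :: "'a \<Rightarrow> real" where "bounded_linear g" "\<And>m. m \<in> M \<Longrightarrow> g m = 0" "g x > 0"
proof -
  have 0: "0 \<in> M" using subspace_0[OF assms(1)] .
  obtain g where g: "linear g" "\<And>y. g y \<le> infdist y M" "g x = infdist x M"
    using hahn_banach[OF sublinear_infdist[OF assms(1)]] by metis
  have "g y \<le> norm y" for y
    using g(2)[of y] infdist_le[OF 0, of y] by simp
  then have "bounded_linear g"
    using g(1) by (rule bounded_linear_of_le_norm(1)[rotated])
  moreover have "g m = 0" if "m \<in> M" for m
    using g(2)[of m] g(2)[of "- m"] that subspace_neg[OF assms(1) that] linear_neg[OF g(1), of m]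
    by simp
  moreover have "g x > 0"
    using g(3) infdist_nonneg[of x M] in_closure_iff_infdist_zero[of M x] assms(2) 0
    by force
  ultimately show thesis by (rule that)
qed

section \<open>Finite-dimensional subspaces, almost orthogonality and finite codimension\<close>

text \<open>Induction on the spanning set. The distance \<open>d\<close> from the new vector to the
  closed old span controls its coefficient, so a ball of the new span lies in the continuous image
  of an interval times a smaller-dimensional ball.\<close>

lemma compact_span_cball:
  fixes E :: "'a::real_normed_vector set"
  assumes "finite E"
  shows "closed (span E) \<and> (\<forall>r. compact (span E \<inter> cball 0 r))"
  using assms
proof (induction E)
  case empty
  have "compact ({0 :: 'a} \<inter> cball 0 r)" for r
    by (intro compact_Int_closed) auto
  then show ?case by simp
next
  case (insert x E)
  then have cl: "closed (span E)" and comp: "\<And>r. compact (span E \<inter> cball 0 r)" by auto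
  show ?case
  proof (cases "x \<in> span E")
    case True
    then have "span (insert x E) = span E" by (rule span_redundant)
    then show ?thesis using insert.IH by simp
  next
    case False
    define d where "d = infdist x (span E)"
    have d: "d > 0"
      using False infdist_nonneg[of x "span E"] in_closed_iff_infdist_zero[OF cl, of x] span_zero[of E]
      unfolding d_def by force
    have coeff: "\<bar>k\<bar> * d \<le> norm (k *\<^sub>R x + w)" if w: "w \<in> span E" for k w
    proof (cases "k = 0")
      case False
      have "d \<le> dist x ((- 1 / k) *\<^sub>R w)"
        unfolding d_def by (rule infdist_le) (rule span_scale[OF w])
      then have "\<bar>k\<bar> * d \<le> \<bar>k\<bar> * norm (x + (1 / k) *\<^sub>R w)"
        by (intro mult_left_mono) (auto simp: dist_norm)
      also have "\<dots> = norm (k *\<^sub>R (x + (1 / k) *\<^sub>R w))" by simp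
      finally show ?thesis using False by (simp add: scaleR_add_right)
    qed auto
    \<comment> \<open>The ball is only sandwiched between a compact set and the span for now. Its
      own compactness needs the span to be closed, which is deduced from this.\<close>
    have comp': "\<exists>K. compact K \<and> span (insert x E) \<inter> cball 0 r \<subseteq> K \<and> K \<subseteq> span (insert x E)" for r
    proof -
      define K where "K = (\<lambda>(k, w). k *\<^sub>R x + w) `
        ({- (r / d)..r / d} \<times> (span E \<inter> cball 0 (r + (r / d) * norm x)))"
      have "compact K"
        unfolding K_def
        by (intro compact_continuous_image compact_Times comp compact_Icc)
           (auto simp: case_prod_beta intro!: continuous_intros)
      moreover have "span (insert x E) \<inter> cball 0 r \<subseteq> K"
      proof
        fix v assume v: "v \<in> span (insert x E) \<inter> cball 0 r"
        then obtain k where k: "v - k *\<^sub>R x \<in> span E" by (auto simp: span_insert)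
        define w where "w = v - k *\<^sub>R x"
        have vkw: "v = k *\<^sub>R x + w" by (simp add: w_def)
        have nv: "norm v \<le> r" using v by simp
        have "\<bar>k\<bar> * d \<le> r"
          using coeff[OF k, of k] nv by simp
        then have kr: "\<bar>k\<bar> \<le> r / d" using d by (simp add: field_simps)
        have "norm w \<le> norm v + \<bar>k\<bar> * norm x"
          unfolding w_def using norm_triangle_ineq4[of v "k *\<^sub>R x"] by simp
        also have "\<dots> \<le> r + (r / d) * norm x"
          using nv kr by (intro add_mono mult_right_mono) auto
        finally have nw: "norm w \<le> r + (r / d) * norm x" .
        have "(k, w) \<in> {- (r / d)..r / d} \<times> (span E \<inter> cball 0 (r + (r / d) * norm x))"
          using kr nw k unfolding w_def[symmetric] by (auto simp: abs_le_iff)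
        then show "v \<in> K"
          unfolding K_def vkw by (intro image_eqI[where x = "(k, w)"]) auto
      qed
      moreover have "K \<subseteq> span (insert x E)"
        unfolding K_def
        using span_mono[of E "insert x E"] by (auto intro!: span_add span_scale[OF span_base])
      ultimately show ?thesis by blast
    qed
    have cl': "closed (span (insert x E))"
      unfolding closed_sequential_limits
    proof (intro allI impI, elim conjE)
      fix f l assume f: "\<forall>n. f n \<in> span (insert x E)" and lim: "f \<longlonglongrightarrow> l"
      obtain r where r: "\<And>n. norm (f n) \<le> r"
        using convergent_imp_bounded[OF lim] by (auto simp: bounded_iff)
      obtain K where K: "compact K" "span (insert x E) \<inter> cball 0 r \<subseteq> K"
          "K \<subseteq> span (insert x E)"
        using comp' by meson
      have "f n \<in> K" for n
        using K(2) f r[of n] by auto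
      then have "l \<in> K"
        using closed_sequentially[OF compact_imp_closed[OF K(1)] _ lim] by blast
      then show "l \<in> span (insert x E)" using K(3) by blast
    qed
    have "compact (span (insert x E) \<inter> cball 0 r)" for r
    proof -
      obtain K where K: "compact K" "span (insert x E) \<inter> cball 0 r \<subseteq> K"
          "K \<subseteq> span (insert x E)"
        using comp' by meson
      have "span (insert x E) \<inter> cball 0 r = K \<inter> (span (insert x E) \<inter> cball 0 r)"
        using K(2) by blast
      then show ?thesis
        using compact_Int_closed[OF K(1), of "span (insert x E) \<inter> cball 0 r"] cl'
        by (metis closed_Int closed_cball)
    qed
    then show ?thesis using cl' by blast
  qed
qed

text \<open>The finite-codimensional subspaces of the argument are given by the functionals that cut
  them out. Intersecting them means uniting sets of functionals, and membership of a weak cluster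
  point can be tested one functional at a time.\<close>

definition common_kernel :: "('a::real_normed_vector \<Rightarrow> real) set \<Rightarrow> 'a set" where
  "common_kernel G = {x. \<forall>g\<in>G. g x = 0}"

lemma common_kernel_antimono: "G \<subseteq> H \<Longrightarrow> common_kernel H \<subseteq> common_kernel G"
  by (auto simp: common_kernel_def)

lemma subspace_common_kernel:
  assumes "\<And>g. g \<in> G \<Longrightarrow> bounded_linear g"
  shows "subspace (common_kernel G)"
  using assms unfolding subspace_def common_kernel_def
  by (auto simp: bounded_linear.linear linear_0 linear_add linear_scale)

text \<open>Mazur's lemma: norm a fine enough net of the compact unit sphere of \<open>span E\<close>.\<close>

lemma mazur_almost_orthogonal:
  fixes E :: "'a::real_normed_vector set"
  assumes "finite E"
  obtains G where "finite G" "\<And>g. g \<in> G \<Longrightarrow> bounded_linear g"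
    "\<And>s z. s \<in> span E \<Longrightarrow> z \<in> common_kernel G \<Longrightarrow> norm s \<le> 2 * norm (s + z)"
proof -
  have "closed (sphere (0::'a) 1)"
    unfolding sphere_def by (intro closed_Collect_eq continuous_intros)
  then have "compact ((span E \<inter> cball 0 1) \<inter> sphere 0 1)"
    using compact_span_cball[OF assms] by (metis compact_Int_closed)
  also have "(span E \<inter> cball 0 1) \<inter> sphere 0 1 = span E \<inter> sphere 0 1" by auto
  finally have "compact (span E \<inter> sphere 0 1)" .
  \<comment> \<open>Radius 1/4 leaves \<open>norm (s + z)\<close> at least 3/4 for unit
    \<open>s\<close>, enough for the factor 2.\<close>
  then obtain N where N: "finite N" "N \<subseteq> span E \<inter> sphere 0 1"
      "span E \<inter> sphere 0 1 \<subseteq> (\<Union>x\<in>N. ball x (1/4))"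
    using compactE_image[of "span E \<inter> sphere 0 1" "span E \<inter> sphere 0 1" "\<lambda>x. ball x (1/4)"]
    by (metis (no_types, lifting) UN_iff centre_in_ball open_ball subsetI zero_less_divide_1_iff zero_less_numeral)
  have "\<exists>g. bounded_linear g \<and> (\<forall>y. \<bar>g y\<bar> \<le> norm y) \<and> g x = norm x" for x :: 'a
    using norming_functional by metis
  then obtain \<phi> :: "'a \<Rightarrow> 'a \<Rightarrow> real" where
    \<phi>: "\<And>x. bounded_linear (\<phi> x)" "\<And>x y. \<bar>\<phi> x y\<bar> \<le> norm y" "\<And>x. \<phi> x x = norm x"
    by metis
  have unit: "1 \<le> 2 * norm (s + z)"
    if s: "s \<in> span E" "norm s = 1" and z: "z \<in> common_kernel (\<phi> ` N)" for s z
  proof -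
    obtain x where x: "x \<in> N" "dist x s < 1/4"
      using N(3) s by fastforce
    have lin: "linear (\<phi> x)" using \<phi>(1) by (rule bounded_linear.linear)
    have "norm x = 1" using N(2) x(1) by auto
    \<comment> \<open>Write \<open>x\<close> as \<open>(s + z) + (x - s) - z\<close>; the functional
      norming \<open>x\<close> kills \<open>z\<close> and is less than 1/4 in modulus at
      \<open>x - s\<close>.\<close>
    then have "1 = \<phi> x (s + z) + \<phi> x (x - s) - \<phi> x z"
      using \<phi>(3)[of x] by (simp add: linear_add[OF lin] linear_diff[OF lin])
    also have "\<phi> x z = 0" using z x(1) by (simp add: common_kernel_def)
    finally show ?thesis
      using \<phi>(2)[of x "s + z"] \<phi>(2)[of x "x - s"] x(2) by (simp add: dist_norm)
  qed
  have "norm s \<le> 2 * norm (s + z)" if s: "s \<in> span E" and z: "z \<in> common_kernel (\<phi> ` N)" for s z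
  proof (cases "s = 0")
    case False
    have "subspace (common_kernel (\<phi> ` N))"
      by (rule subspace_common_kernel) (use \<phi>(1) in auto)
    then have "1 \<le> 2 * norm ((1 / norm s) *\<^sub>R s + (1 / norm s) *\<^sub>R z)"
      using s z False by (intro unit) (auto intro: span_scale subspace_scale)
    also have "\<dots> = 2 * (norm (s + z) / norm s)"
      by (simp flip: scaleR_add_right)
    finally show ?thesis using False by (simp add: field_simps)
  qed auto
  then show thesis
    using that[of "\<phi> ` N"] N(1) \<phi>(1) by blast
qed

text \<open>Each further functional costs at most one dimension: a vector \<open>u\<close> of the
  old kernel with \<open>g u \<noteq> 0\<close> corrects the value of \<open>g\<close>, and without
  such a vector the kernel does not shrink.\<close>

lemma finite_codim_common_kernel:
  fixes G :: "('a::real_normed_vector \<Rightarrow> real) set"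
  assumes "finite G" "\<And>g. g \<in> G \<Longrightarrow> bounded_linear g"
  shows "\<exists>B. finite B \<and> (\<forall>x. \<exists>b\<in>span B. x - b \<in> common_kernel G)"
  using assms
proof (induction G)
  case empty
  have "\<forall>x. \<exists>b\<in>span {}. x - b \<in> common_kernel ({} :: ('a \<Rightarrow> real) set)"
    by (auto simp: common_kernel_def)
  then show ?case by blast
next
  case (insert g G)
  then obtain B where B: "finite B" "\<And>x. \<exists>b\<in>span B. x - b \<in> common_kernel G" by auto
  have lin: "linear h" if "h \<in> insert g G" for h
    using insert.prems that by (auto intro: bounded_linear.linear)
  have sub: "subspace (common_kernel G)"
    using insert.prems by (intro subspace_common_kernel) auto
  show ?case
  proof (cases "\<exists>u\<in>common_kernel G. g u \<noteq> 0")
    case True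
    then obtain u where u: "u \<in> common_kernel G" "g u \<noteq> 0" by blast
    have "\<exists>b\<in>span (insert u B). x - b \<in> common_kernel (insert g G)" for x
    proof -
      obtain b where b: "b \<in> span B" "x - b \<in> common_kernel G" using B(2) by blast
      define c where "c = g (x - b) / g u"
      have "(x - b) - c *\<^sub>R u \<in> common_kernel G"
        using subspace_diff[OF sub b(2) subspace_scale[OF sub u(1)]] .
      moreover have "g ((x - b) - c *\<^sub>R u) = 0"
        using u(2) lin[of g] by (simp add: c_def linear_diff linear_scale)
      ultimately have "x - (b + c *\<^sub>R u) \<in> common_kernel (insert g G)"
        by (simp add: common_kernel_def diff_diff_eq)
      moreover have "b + c *\<^sub>R u \<in> span (insert u B)"
        using b(1) span_mono[of B "insert u B"]
        by (intro span_add span_scale[OF span_base]) auto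
      ultimately show ?thesis by blast
    qed
    then show ?thesis using B(1) by blast
  next
    case False
    then have "common_kernel G \<subseteq> common_kernel (insert g G)" by (auto simp: common_kernel_def)
    then show ?thesis using B by blast
  qed
qed

section \<open>Greedy finite covers and Koenig's lemma\<close>

text \<open>If every finite subset of \<open>S\<close> left a vector of \<open>S\<close> uncovered,
  adjoining such vectors one after the other would produce a separated sequence.\<close>

lemma finite_cover_of_no_separated:
  fixes S :: "'a::real_normed_vector set"
  assumes "\<nexists>x :: nat \<Rightarrow> 'a. range x \<subseteq> S \<and> symmetrically_separated \<delta> x"
  shows "\<exists>F. finite F \<and> F \<subseteq> S \<and> (\<forall>v\<in>S. \<exists>x\<in>F. norm (x + v) < \<delta> \<or> norm (x - v) < \<delta>)"
proof (rule ccontr)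
  assume "\<not> ?thesis"
  then have "\<exists>v\<in>S. \<forall>x\<in>F. norm (x + v) \<ge> \<delta> \<and> norm (x - v) \<ge> \<delta>" if "finite F" "F \<subseteq> S" for F
    using that by (metis not_less)
  then obtain c where c: "\<And>F. finite F \<Longrightarrow> F \<subseteq> S \<Longrightarrow> c F \<in> S"
    "\<And>F x. finite F \<Longrightarrow> F \<subseteq> S \<Longrightarrow> x \<in> F \<Longrightarrow> norm (x + c F) \<ge> \<delta> \<and> norm (x - c F) \<ge> \<delta>"
    by metis
  define A where "A = rec_nat {} (\<lambda>_ B. insert (c B) B)"
  have A_Suc: "A (Suc n) = insert (c (A n)) (A n)" for n by (simp add: A_def)
  have A: "finite (A n) \<and> A n \<subseteq> S" for n
    by (induction n) (auto simp: A_Suc c(1), auto simp: A_def)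
  have mono: "n \<le> m \<Longrightarrow> A n \<subseteq> A m" for n m
    by (rule lift_Suc_mono_le[of A]) (auto simp: A_Suc)
  \<comment> \<open>The earlier choice \<open>c (A n)\<close> belongs to \<open>A m\<close>, and
    \<open>c (A m)\<close> was chosen far from all of \<open>A m\<close>.\<close>
  have sep: "norm (c (A n) + c (A m)) \<ge> \<delta> \<and> norm (c (A n) - c (A m)) \<ge> \<delta>" if "n < m" for n m
    using mono[of "Suc n" m] that A[of m] by (intro c(2)) (auto simp: A_Suc)
  have "symmetrically_separated \<delta> (\<lambda>n. c (A n))"
    unfolding symmetrically_separated_def
    by (metis sep nat_neq_iff add.commute norm_minus_commute)
  moreover have "range (\<lambda>n. c (A n)) \<subseteq> S" using A c(1) by blast
  ultimately show False using assms by blast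
qed

text \<open>Here \<open>p n\<close> stands for a path of length \<open>n\<close>. The pigeonhole
  principle, coordinate by coordinate, gives nested infinite sets of paths that agree in one more
  coordinate each time.\<close>

lemma koenig:
  fixes F :: "nat \<Rightarrow> 'a set" and p :: "nat \<Rightarrow> nat \<Rightarrow> 'a"
  assumes "\<And>n. finite (F n)" "\<And>n i. i < n \<Longrightarrow> p n i \<in> F i"
  obtains x where "\<And>n. x n \<in> F n" "\<And>n. \<exists>m\<ge>n. \<forall>i<n. p m i = x i"
proof -
  \<comment> \<open>A state holds the surviving indices and their common value at coordinate
    \<open>n\<close>. Demanding \<open>n < m\<close> keeps \<open>p m n\<close> inside the finite
    set \<open>F n\<close>.\<close>
  define P where "P n s \<longleftrightarrow> infinite (fst s) \<and> (\<forall>m\<in>fst s. n < m \<and> p m n = snd s)"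
    for n :: nat and s :: "nat set \<times> 'a"
  have step: "\<exists>s. P n s \<and> fst s \<subseteq> I" if I: "infinite I" for I n
  proof -
    have "infinite (I \<inter> {n<..})"
    proof
      assume "finite (I \<inter> {n<..})"
      then have "finite ((I \<inter> {n<..}) \<union> {..n})" by simp
      then show False using I finite_subset[of I "(I \<inter> {n<..}) \<union> {..n}"] by force
    qed
    moreover have "finite ((\<lambda>m. p m n) ` (I \<inter> {n<..}))"
      using assms by (intro finite_subset[OF _ assms(1)[of n]]) auto
    ultimately obtain k where "k \<in> I \<inter> {n<..}"
        "infinite {m \<in> I \<inter> {n<..}. p m n = p k n}"
      using pigeonhole_infinite[of "I \<inter> {n<..}" "\<lambda>m. p m n"] by blast
    then have "P n ({m \<in> I \<inter> {n<..}. p m n = p k n}, p k n)"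
      unfolding P_def by simp
    then show ?thesis by (intro exI conjI) auto
  qed
  have "\<exists>s. \<forall>n. P n (s n) \<and> fst (s (Suc n)) \<subseteq> fst (s n)"
  proof (rule dependent_nat_choice)
    show "\<exists>s. P 0 s" using step[OF infinite_UNIV_nat] by blast
    show "\<exists>t. P (Suc n) t \<and> fst t \<subseteq> fst s" if "P n s" for s n
      using step that by (simp add: P_def)
  qed
  then obtain s where s: "\<And>n. P n (s n)" "\<And>n. fst (s (Suc n)) \<subseteq> fst (s n)"
    by blast
  have mem: "\<exists>m\<in>fst (s n). True" for n
    using s(1)[of n] by (metis P_def finite.emptyI ex_in_conv)
  have anti: "fst (s n) \<subseteq> fst (s i)" if "i \<le> n" for i n
    using lift_Suc_antimono_le[of "\<lambda>n. fst (s n)", OF s(2) that] .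
  have "snd (s n) \<in> F n" for n
  proof -
    obtain m where "m \<in> fst (s n)" using mem by blast
    then show ?thesis using s(1)[of n] assms(2)[of n m] by (auto simp: P_def)
  qed
  moreover have "\<exists>m\<ge>n. \<forall>i<n. p m i = snd (s i)" for n
  proof -
    obtain m where m: "m \<in> fst (s n)" using mem by blast
    have "n \<le> m" using m s(1)[of n] by (auto simp: P_def)
    moreover have "p m i = snd (s i)" if "i < n" for i
      using anti[of i n] m that s(1)[of i] by (auto simp: P_def)
    ultimately show ?thesis by blast
  qed
  ultimately show thesis using that[of "\<lambda>n. snd (s n)"] by simp
qed

section \<open>Real reflexivity and weak cluster points\<close>

lemma dual_scaleR:
  "normed_space_over.dual (scaleR :: real \<Rightarrow> 'a::real_normed_vector \<Rightarrow> 'a) = {f. bounded_linear f}"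
proof -
  have "Vector_Spaces.linear scaleR (*) f" if "bounded_linear f" for f :: "'a \<Rightarrow> real"
    using that bounded_linear.linear[OF that] by (simp add: linear_def real_scaleR_def[abs_def])
  then show ?thesis
    unfolding normed_space_over.dual_def[OF normed_space_over_real] by blast
qed

lemma infinite_dimensional_scaleR:
  "normed_space_over.infinite_dimensional (scaleR :: real \<Rightarrow> 'a::real_normed_vector \<Rightarrow> 'a) \<longleftrightarrow>
    \<not> (\<exists>B :: 'a set. finite B \<and> span B = UNIV)"
  unfolding normed_space_over.infinite_dimensional_def[OF normed_space_over_real] span_raw_def ..

text \<open>The functional \<open>f \<mapsto> limsup (f (s n))\<close> is sublinear, and a linear functional below it is
  represented by a weak cluster point.\<close>

lemma weak_cluster_point:
  fixes s :: "nat \<Rightarrow> 'a::real_normed_vector"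
  assumes refl: "normed_space_over.reflexive (scaleR :: real \<Rightarrow> 'a \<Rightarrow> 'a)"
    and bdd: "\<And>n. norm (s n) \<le> R"
  shows "\<exists>a. \<forall>f n c. bounded_linear f \<longrightarrow> (\<forall>k\<ge>n. f (s k) \<le> c) \<longrightarrow> f a \<le> (c::real)"
proof -
  have abs: "\<bar>blinfun_apply f (s k)\<bar> \<le> R * norm f" for f :: "'a \<Rightarrow>\<^sub>L real" and k
  proof -
    have "\<bar>blinfun_apply f (s k)\<bar> \<le> norm f * norm (s k)"
      using norm_blinfun[of f "s k"] by simp
    also have "\<dots> \<le> R * norm f"
      using mult_left_mono[OF bdd[of k] norm_ge_zero[of f]] by (simp add: mult.commute)
    finally show ?thesis .
  qed
  \<comment> \<open>The bounded functionals are handled as a type here because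
    \<open>hahn_banach\<close> needs a real vector space for its domain.\<close>
  define q where "q n f = (SUP k\<in>{n..}. blinfun_apply f (s k))" for n and f :: "'a \<Rightarrow>\<^sub>L real"
  have bdd_above: "bdd_above ((\<lambda>k. blinfun_apply f (s k)) ` A)" for f :: "'a \<Rightarrow>\<^sub>L real" and A
    by (rule bdd_aboveI2[of _ _ "R * norm f"]) (use abs[of f] in \<open>auto simp: abs_le_iff\<close>)
  have q_upper: "blinfun_apply f (s k) \<le> q n f" if "k \<ge> n" for f n k
    unfolding q_def by (rule cSUP_upper[OF _ bdd_above]) (use that in auto)
  have q_least: "q n f \<le> c" if "\<And>k. k \<ge> n \<Longrightarrow> blinfun_apply f (s k) \<le> c" for f n c
    unfolding q_def by (rule cSUP_least) (use that in auto)
  have sub: "sublinear (q n)" for n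
  proof (rule sublinearI)
    fix f g show "q n (f + g) \<le> q n f + q n g"
      by (rule q_least) (auto simp: blinfun.add_left intro!: add_mono q_upper)
  next
    fix t :: real and f assume "t > 0"
    then show "q n (t *\<^sub>R f) \<le> t * q n f"
      by (intro q_least) (auto simp: blinfun.scaleR_left intro!: q_upper)
  qed
  have anti: "q m \<le> q n" if "n \<le> m" for n m
    using that by (auto simp: le_fun_def intro!: q_least q_upper)
  \<comment> \<open>The suprema over tails decrease with \<open>n\<close>, so this infimum is the
    limsup and the functionals \<open>q n\<close> form a chain.\<close>
  define p where "p f = (INF r\<in>range q. r f)" for f
  have bdd_below: "bdd_below ((\<lambda>r. r f) ` range q)" for f
  proof (rule bdd_belowI2)
    fix r assume "r \<in> range q"
    then obtain n where "r = q n" by blast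
    then show "- (R * norm f) \<le> r f"
      using abs[of f n] q_upper[of n n f] by simp
  qed
  have "sublinear p"
    unfolding p_def
  proof (rule sublinear_INF_chain)
    fix r r' assume "r \<in> range q" "r' \<in> range q"
    then show "r \<le> r' \<or> r' \<le> r" using anti by (metis imageE nle_le)
  qed (use sub bdd_below in auto)
  then obtain \<Phi> where \<Phi>: "linear \<Phi>" "\<And>f. \<Phi> f \<le> p f"
    using hahn_banach[of p 0] by blast
  have \<Phi>_le: "\<Phi> f \<le> c" if "\<And>k. k \<ge> n \<Longrightarrow> blinfun_apply f (s k) \<le> c" for f n c
  proof -
    have "p f \<le> q n f"
      unfolding p_def by (rule cINF_lower[OF bdd_below]) auto
    then show ?thesis using \<Phi>(2)[of f] q_least[of n f c] that by force
  qed
  \<comment> \<open>Back to plain functions, as \<open>bidual\<close> expects. What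
    \<open>Blinfun\<close> returns on functions that are not bounded linear is harmless, since
    \<open>bidual\<close> constrains values on \<open>dual\<close> only.\<close>
  define \<Psi> where "\<Psi> f = \<Phi> (Blinfun f)" for f
  have "\<Psi> \<in> normed_space_over.bidual (scaleR :: real \<Rightarrow> 'a \<Rightarrow> 'a)"
    unfolding normed_space_over.bidual_def[OF normed_space_over_real] dual_scaleR mem_Collect_eq
  proof (intro conjI ballI allI exI)
    fix f g :: "'a \<Rightarrow> real" assume fg: "f \<in> {f. bounded_linear f}" "g \<in> {f. bounded_linear f}"
    then have "Blinfun (\<lambda>x. f x + g x) = Blinfun f + Blinfun g"
      by (intro blinfun_eqI) (simp add: bounded_linear_Blinfun_apply bounded_linear_add blinfun.add_left)
    then show "\<Psi> (\<lambda>x. f x + g x) = \<Psi> f + \<Psi> g"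
      by (simp add: \<Psi>_def linear_add[OF \<Phi>(1)])
  next
    fix c :: real and f :: "'a \<Rightarrow> real" assume f: "f \<in> {f. bounded_linear f}"
    then have "Blinfun (\<lambda>x. c * f x) = c *\<^sub>R Blinfun f"
      by (intro blinfun_eqI)
         (simp add: bounded_linear_Blinfun_apply bounded_linear_const_mult blinfun.scaleR_left)
    then show "\<Psi> (\<lambda>x. c * f x) = c * \<Psi> f"
      by (simp add: \<Psi>_def linear_scale[OF \<Phi>(1)])
  next
    fix f :: "'a \<Rightarrow> real" assume f: "f \<in> {f. bounded_linear f}"
    have "\<Phi> g \<le> R * norm g" for g
      by (rule \<Phi>_le[of 0]) (use abs[of g] in \<open>auto simp: abs_le_iff\<close>)
    from this[of "Blinfun f"] this[of "- Blinfun f"] have "\<bar>\<Psi> f\<bar> \<le> R * norm (Blinfun f)"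
      by (simp add: \<Psi>_def linear_neg[OF \<Phi>(1)])
    then show "norm (\<Psi> f) \<le> R * onorm f"
      using f by (simp add: norm_blinfun.rep_eq bounded_linear_Blinfun_apply)
  qed
  then obtain a where a: "\<And>f. bounded_linear f \<Longrightarrow> \<Psi> f = f a"
    using refl unfolding normed_space_over.reflexive_def[OF normed_space_over_real] dual_scaleR
    by blast
  have "f a \<le> c" if f: "bounded_linear f" "\<And>k. k \<ge> n \<Longrightarrow> f (s k) \<le> c" for f n and c :: real
    using \<Phi>_le[of n "Blinfun f" c] f a[OF f(1)] by (simp add: \<Psi>_def bounded_linear_Blinfun_apply)
  then show ?thesis by blast
qed

section \<open>Finite covers in subspaces of finite codimension\<close>

lemma common_kernel_nontrivial:
  fixes G :: "('a::real_normed_vector \<Rightarrow> real) set"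
  assumes "normed_space_over.infinite_dimensional (scaleR :: real \<Rightarrow> 'a \<Rightarrow> 'a)"
    and "finite G" "\<And>g. g \<in> G \<Longrightarrow> bounded_linear g"
  shows "common_kernel G \<inter> sphere 0 1 \<noteq> {}"
proof -
  obtain B where B: "finite B" "\<And>x. \<exists>b\<in>span B. x - b \<in> common_kernel G"
    using finite_codim_common_kernel[OF assms(2,3)] by metis
  have "span B \<noteq> UNIV" using assms(1) B(1) by (auto simp: infinite_dimensional_scaleR)
  then obtain x b where x: "x \<notin> span B" "b \<in> span B" "x - b \<in> common_kernel G"
    using B(2) by blast
  then have "x - b \<noteq> 0" by auto
  then have "(1 / norm (x - b)) *\<^sub>R (x - b) \<in> common_kernel G \<inter> sphere 0 1"
    using subspace_scale[OF subspace_common_kernel[of G, OF assms(3)] x(3)] by auto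
  then show ?thesis by blast
qed

text \<open>Convexity transfers the covering property from unit vectors \<open>v\<close> to all \<open>u \<in> Z\<close>.\<close>

lemma cover_step:
  fixes Z :: "'a::real_normed_vector set"
  assumes Z: "subspace Z" and ne: "Z \<inter> sphere 0 1 \<noteq> {}" and \<epsilon>: "\<epsilon> > 0"
    and nosep: "\<nexists>x :: nat \<Rightarrow> 'a. range x \<subseteq> sphere 0 1 \<and> symmetrically_separated (1 + \<epsilon>) x"
  obtains F where "finite F" "F \<subseteq> Z \<inter> sphere 0 1"
    "\<And>u. u \<in> Z \<Longrightarrow> \<exists>x\<in>F. norm (x + u) \<le> max 1 (norm u) + \<epsilon>"
proof -
  have "\<nexists>x :: nat \<Rightarrow> 'a. range x \<subseteq> Z \<inter> sphere 0 1 \<and> symmetrically_separated (1 + \<epsilon>) x"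
    using nosep by blast
  from finite_cover_of_no_separated[OF this] obtain F where F: "finite F" "F \<subseteq> Z \<inter> sphere 0 1"
    "\<And>v. v \<in> Z \<inter> sphere 0 1 \<Longrightarrow> \<exists>x\<in>F. norm (x + v) < 1 + \<epsilon> \<or> norm (x - v) < 1 + \<epsilon>"
    by blast
  \<comment> \<open>Adding the negatives of \<open>F\<close> absorbs the choice of sign in the
    cover.\<close>
  have unit: "\<exists>x\<in>F \<union> uminus ` F. norm x = 1 \<and> norm (x + v) < 1 + \<epsilon>" if v: "v \<in> Z \<inter> sphere 0 1" for v
  proof -
    obtain x where x: "x \<in> F" "norm (x + v) < 1 + \<epsilon> \<or> norm (x - v) < 1 + \<epsilon>"
      using F(3)[OF v] by blast
    moreover have "norm (- x + v) = norm (x - v)" using norm_minus_commute[of v x] by simp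
    moreover have "norm x = 1" using x(1) F(2) by auto
    ultimately show ?thesis by (metis UnI1 UnI2 imageI norm_minus_cancel)
  qed
  have "\<exists>x\<in>F \<union> uminus ` F. norm (x + u) \<le> max 1 (norm u) + \<epsilon>" if u: "u \<in> Z" for u
  proof -
    obtain v where v: "v \<in> Z \<inter> sphere 0 1" "u = norm u *\<^sub>R v"
    proof (cases "u = 0")
      case True
      then show ?thesis using ne that by fastforce
    next
      case False
      have "(1 / norm u) *\<^sub>R u \<in> Z \<inter> sphere 0 1"
        using subspace_scale[OF Z u] False by auto
      then show ?thesis by (rule that) (use False in simp)
    qed
    then obtain x where x: "x \<in> F \<union> uminus ` F" "norm x = 1" "norm (x + v) < 1 + \<epsilon>"
      using unit by blast
    define t where "t = norm u"
    have nv: "norm v = 1" and ut: "u = t *\<^sub>R v" and t: "t \<ge> 0" using v by (auto simp: t_def)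
    have "norm (x + u) \<le> max 1 t + \<epsilon>"
    proof (cases "t \<le> 1")
      case True
      \<comment> \<open>Inside the unit ball \<open>x + u\<close> is a convex combination of
        \<open>x + v\<close> and \<open>x\<close>, whose norms are at most
        \<open>1 + \<epsilon>\<close> and 1.\<close>
      have "x + u = t *\<^sub>R (x + v) + (1 - t) *\<^sub>R x" by (simp add: ut algebra_simps)
      then have "norm (x + u) \<le> t * norm (x + v) + (1 - t)"
        using norm_triangle_ineq[of "t *\<^sub>R (x + v)" "(1 - t) *\<^sub>R x"] True t x(2) by simp
      also have "\<dots> \<le> t * (1 + \<epsilon>) + (1 - t)"
        using x(3) t by (intro add_right_mono mult_left_mono) auto
      also have "\<dots> \<le> 1 + \<epsilon>" using True \<epsilon> t by (simp add: algebra_simps mult_left_le_one_le)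
      finally show ?thesis by simp
    next
      case False
      \<comment> \<open>Outside the unit ball the excess \<open>t - 1\<close> of \<open>u\<close>
        over \<open>v\<close> is simply added to the bound.\<close>
      have "x + u = (x + v) + (t - 1) *\<^sub>R v" by (simp add: ut algebra_simps)
      then have "norm (x + u) \<le> norm (x + v) + (t - 1)"
        using norm_triangle_ineq[of "x + v" "(t - 1) *\<^sub>R v"] False nv
        by (simp add: add.assoc)
      then show ?thesis using x(3) False by simp
    qed
    then show ?thesis using x(1) unfolding t_def by blast
  qed
  moreover have "F \<union> uminus ` F \<subseteq> Z \<inter> sphere 0 1"
    using F(2) subspace_neg[OF Z] by auto
  ultimately show thesis using that[of "F \<union> uminus ` F"] F(1) by blast
qed

section \<open>The real case: bounded partial sums and the contradiction\<close>

lemma separated_sequence_real: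
  assumes inf: "normed_space_over.infinite_dimensional (scaleR :: real \<Rightarrow> 'a::real_normed_vector \<Rightarrow> 'a)"
    and refl: "normed_space_over.reflexive (scaleR :: real \<Rightarrow> 'a \<Rightarrow> 'a)"
  shows "\<exists>\<epsilon>>0. \<exists>x :: nat \<Rightarrow> 'a. range x \<subseteq> sphere 0 1 \<and> symmetrically_separated (1 + \<epsilon>) x"
proof (rule ccontr)
  assume contra: "\<not> ?thesis"
  \<comment> \<open>The errors halve with \<open>n\<close> so that all of them together stay below
    1.\<close>
  define good where "good n G F \<longleftrightarrow> finite G \<and> (\<forall>g\<in>G. bounded_linear g) \<and> finite F \<and>
    F \<subseteq> common_kernel G \<inter> sphere 0 1 \<and>
    (\<forall>u\<in>common_kernel G. \<exists>x\<in>F. norm (x + u) \<le> max 1 (norm u) + (1/2) ^ Suc n)"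
    for n and G :: "('a \<Rightarrow> real) set" and F :: "'a set"
  have ex_good: "\<exists>F. good n G F" if G: "finite G" "\<And>g. g \<in> G \<Longrightarrow> bounded_linear g" for n G
  proof -
    have eps: "(1/2 :: real) ^ Suc n > 0" by simp
    then have "\<nexists>x :: nat \<Rightarrow> 'a. range x \<subseteq> sphere 0 1 \<and> symmetrically_separated (1 + (1/2) ^ Suc n) x"
      using contra by blast
    from cover_step[OF subspace_common_kernel[of G, OF G(2)]
        common_kernel_nontrivial[OF inf G] eps this]
    show ?thesis using G unfolding good_def by (metis (no_types, lifting))
  qed
  \<comment> \<open>A state is a triple: the functionals cutting out \<open>Z n\<close>, the
    collected earlier covers \<open>E n\<close>, and the current cover \<open>F n\<close>.\<close>
  define valid where "valid n s \<longleftrightarrow> good n (fst s) (snd (snd s)) \<and> finite (fst (snd s))"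
    for n and s :: "('a \<Rightarrow> real) set \<times> 'a set \<times> 'a set"
  define extends where "extends s t \<longleftrightarrow> fst s \<subseteq> fst t \<and> fst (snd t) = fst (snd s) \<union> snd (snd s) \<and>
      (\<forall>u\<in>span (fst (snd t)). \<forall>z\<in>common_kernel (fst t). norm u \<le> 2 * norm (u + z))"
    for s t :: "('a \<Rightarrow> real) set \<times> 'a set \<times> 'a set"
  have "\<exists>s. \<forall>n. valid n (s n) \<and> extends (s n) (s (Suc n))"
  proof (rule dependent_nat_choice)
    obtain F where "good 0 {} F" using ex_good[of "{}" 0] by auto
    then show "\<exists>s. valid 0 s"
      by (intro exI[of _ "({}, {}, F)"]) (simp add: valid_def)
  next
    fix s n assume "valid n s"
    moreover obtain G E F where s: "s = (G, E, F)" by (cases s) auto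
    ultimately have g: "good n G F" "finite E" by (auto simp: valid_def)
    then have fin: "finite (E \<union> F)" by (simp add: good_def)
    \<comment> \<open>Mazur is applied with the current \<open>F\<close> included, so the next
      kernel is almost orthogonal to every cover chosen so far.\<close>
    obtain H where H: "finite H" "\<And>g. g \<in> H \<Longrightarrow> bounded_linear g"
      "\<And>u z. u \<in> span (E \<union> F) \<Longrightarrow> z \<in> common_kernel H \<Longrightarrow> norm u \<le> 2 * norm (u + z)"
      using mazur_almost_orthogonal[OF fin] by blast
    have GH: "finite (G \<union> H)" "\<And>g. g \<in> G \<union> H \<Longrightarrow> bounded_linear g"
      using H g by (auto simp: good_def)
    then obtain F' where F': "good (Suc n) (G \<union> H) F'"
      using ex_good by meson
    have "common_kernel (G \<union> H) \<subseteq> common_kernel H" by (rule common_kernel_antimono) simp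
    then have "extends s (G \<union> H, E \<union> F, F')"
      using H(3) by (auto simp: s extends_def)
    then show "\<exists>t. valid (Suc n) t \<and> extends s t"
      using F' fin by (intro exI[of _ "(G \<union> H, E \<union> F, F')"]) (simp add: valid_def)
  qed
  then obtain S where S: "\<And>n. valid n (S n)" "\<And>n. extends (S n) (S (Suc n))"
    by blast
  define G E F where "G n = fst (S n)" and "E n = fst (snd (S n))" and "F n = snd (snd (S n))" for n
  define Z where "Z n = common_kernel (G n)" for n
  have good: "good n (G n) (F n)" for n
    using S(1)[of n] by (simp add: valid_def G_def F_def)
  have G_mono: "G n \<subseteq> G (Suc n)" and E_Suc: "E (Suc n) = E n \<union> F n"
    and mazur: "\<And>s z. s \<in> span (E (Suc n)) \<Longrightarrow> z \<in> Z (Suc n) \<Longrightarrow> norm s \<le> 2 * norm (s + z)" for n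
    using S(2)[of n] by (auto simp: extends_def G_def E_def F_def Z_def)
  have G_mono': "G m \<subseteq> G n" if "m \<le> n" for m n
    using lift_Suc_mono_le[of G, OF G_mono that] .
  have Z_anti: "Z n \<subseteq> Z m" if "m \<le> n" for m n
    unfolding Z_def by (rule common_kernel_antimono[OF G_mono'[OF that]])
  have Z_sub: "subspace (Z n)" for n
    unfolding Z_def by (rule subspace_common_kernel) (use good in \<open>auto simp: good_def\<close>)
  have F_fin: "finite (F n)" and F_Z: "F n \<subseteq> Z n" and F_norm: "\<And>x. x \<in> F n \<Longrightarrow> norm x = 1"
    and F_cover: "\<And>u. u \<in> Z n \<Longrightarrow> \<exists>x\<in>F n. norm (x + u) \<le> max 1 (norm u) + (1/2) ^ Suc n" for n
    using good[of n] by (auto simp: good_def Z_def)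
  have E_mono: "E m \<subseteq> E n" if "m \<le> n" for m n
    using lift_Suc_mono_le[of E m n] E_Suc that by simp
  have F_E: "F m \<subseteq> E n" if "m < n" for m n
    using E_mono[of "Suc m" n] E_Suc that by auto

  \<comment> \<open>Induction on the length with the start \<open>n\<close> free: the later vectors
    come first, and the one in \<open>F n\<close> is then chosen against their sum \<open>u\<close>.
    The bound starts at 1 so that it also dominates \<open>max 1 (norm u)\<close>.\<close>
  have tail: "\<exists>x. (\<forall>i\<in>{n..<n+k}. x i \<in> F i) \<and> (\<Sum>i\<in>{n..<n+k}. x i) \<in> Z n \<and>
      norm (\<Sum>i\<in>{n..<n+k}. x i) \<le> 1 + (\<Sum>i\<in>{n..<n+k}. (1/2) ^ Suc i)" for n k
  proof (induction k arbitrary: n)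
    case 0
    then show ?case using subspace_0[OF Z_sub] by simp
  next
    case (Suc k)
    obtain x where x: "\<forall>i\<in>{Suc n..<Suc n+k}. x i \<in> F i" "(\<Sum>i\<in>{Suc n..<Suc n+k}. x i) \<in> Z (Suc n)"
      "norm (\<Sum>i\<in>{Suc n..<Suc n+k}. x i) \<le> 1 + (\<Sum>i\<in>{Suc n..<Suc n+k}. (1/2) ^ Suc i)"
      using Suc.IH by blast
    define u where "u = (\<Sum>i\<in>{Suc n..<Suc n+k}. x i)"
    have uZ: "u \<in> Z n" using x(2) Z_anti[of n "Suc n"] by (auto simp: u_def)
    obtain w where w: "w \<in> F n" "norm (w + u) \<le> max 1 (norm u) + (1/2) ^ Suc n"
      using F_cover[OF uZ] by blast
    have split: "{n..<n + Suc k} = insert n {Suc n..<Suc n + k}" by auto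
    define y where "y = x(n := w)"
    have sum_y: "(\<Sum>i\<in>{n..<n + Suc k}. y i) = w + u"
      unfolding split by (simp add: y_def u_def)
    have "max 1 (norm u) \<le> 1 + (\<Sum>i\<in>{Suc n..<Suc n+k}. (1/2) ^ Suc i)"
    proof (rule max.boundedI)
      have "0 \<le> (\<Sum>i\<in>{Suc n..<Suc n+k}. (1/2 :: real) ^ Suc i)" by (rule sum_nonneg) simp
      then show "1 \<le> 1 + (\<Sum>i\<in>{Suc n..<Suc n+k}. (1/2 :: real) ^ Suc i)" by linarith
    qed (use x(3) u_def in simp)
    moreover have "(\<Sum>i\<in>{n..<n + Suc k}. (1/2 :: real) ^ Suc i) =
        (1/2) ^ Suc n + (\<Sum>i\<in>{Suc n..<Suc n+k}. (1/2) ^ Suc i)"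
      unfolding split by (rule sum.insert) auto
    ultimately have "norm (w + u) \<le> 1 + (\<Sum>i\<in>{n..<n + Suc k}. (1/2) ^ Suc i)"
      using w(2) by linarith
    moreover have "w + u \<in> Z n"
      using w(1) F_Z uZ Z_sub by (auto intro: subspace_add)
    moreover have "\<forall>i\<in>{n..<n + Suc k}. y i \<in> F i"
      using w(1) x(1) unfolding split by (auto simp: y_def)
    ultimately show ?case using sum_y by metis
  qed
  have "\<exists>x. (\<forall>i<n. x i \<in> F i) \<and> norm (\<Sum>i<n. x i) \<le> 2" for n
  proof -
    obtain x where x: "\<forall>i\<in>{0..<0+n}. x i \<in> F i"
      "norm (\<Sum>i\<in>{0..<0+n}. x i) \<le> 1 + (\<Sum>i\<in>{0..<0+n}. (1/2) ^ Suc i)"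
      using tail[of 0 n] by blast
    have "(\<Sum>i<n. (1/2 :: real) ^ Suc i) = 1 - (1/2) ^ n"
      by (induction n) auto
    then have "(\<Sum>i<n. (1/2 :: real) ^ Suc i) \<le> 1" by simp
    then show ?thesis using x by (intro exI[of _ x]) (auto simp: atLeast0LessThan)
  qed
  then obtain p where p: "\<And>n i. i < n \<Longrightarrow> p n i \<in> F i" "\<And>n. norm (\<Sum>i<n. p n i) \<le> 2"
    by metis
  obtain x where x: "\<And>n. x n \<in> F n" "\<And>n. \<exists>m\<ge>n. \<forall>i<n. p m i = x i"
    using koenig[of F p, OF F_fin p(1)] by blast

  have sumE: "(\<Sum>i<n. c i *\<^sub>R x i) \<in> span (E n)" for n c
    using x(1) F_E by (intro span_sum span_scale span_base) blast
  define s where "s n = (\<Sum>i<n. x i)" for n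
  have s_E: "s n \<in> span (E n)" for n
    using sumE[of "\<lambda>_. 1" n] by (simp add: s_def)
  have tail_Z: "(\<Sum>i\<in>{n..<m}. y i) \<in> Z n" if "\<And>i. i < m \<Longrightarrow> y i \<in> F i" for n m y
    using that F_Z Z_anti by (intro subspace_sum[OF Z_sub]) (meson atLeastLessThan_iff subsetD)
  have split: "(\<Sum>i<m. y i) = (\<Sum>i<n. y i) + (\<Sum>i\<in>{n..<m}. y i)" if "n \<le> m" for n m and y :: "nat \<Rightarrow> 'a"
    using sum.atLeastLessThan_concat[of 0 n m y] that by (simp add: atLeast0LessThan)
  \<comment> \<open>Compare with a finite path \<open>p m\<close> that begins like \<open>x\<close>:
    its full sum has norm at most 2, its remainder lies in \<open>Z n\<close>, and almost
    orthogonality costs a factor 2. That estimate starts at index 1, hence the separate case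
    0.\<close>
  have s_bdd: "norm (s n) \<le> 4" for n
  proof (cases n)
    case (Suc k)
    obtain m where m: "m \<ge> n" "\<forall>i<n. p m i = x i" using x(2) by blast
    have "norm (s n) \<le> 2 * norm (s n + (\<Sum>i\<in>{n..<m}. p m i))"
      using s_E[of n] tail_Z[of m "p m" n] p(1) unfolding Suc by (intro mazur) auto
    also have "s n + (\<Sum>i\<in>{n..<m}. p m i) = (\<Sum>i<m. p m i)"
      using m by (simp add: split[OF m(1)] s_def)
    finally show ?thesis using p(2)[of m] by simp
  qed (simp add: s_def)

  obtain a where "\<forall>f n c. bounded_linear f \<longrightarrow> (\<forall>k\<ge>n. f (s k) \<le> c) \<longrightarrow> f a \<le> (c::real)"
    using weak_cluster_point[OF refl, of s 4] s_bdd by blast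
  then have a: "f a \<le> c" if "bounded_linear f" "\<And>k. k \<ge> n \<Longrightarrow> f (s k) \<le> c" for f n and c :: real
    using that by blast
  have a_eq: "f a = c" if f: "bounded_linear f" and c: "\<And>k. k \<ge> n \<Longrightarrow> f (s k) = c" for f n and c :: real
  proof (rule antisym)
    show "f a \<le> c" using a[OF f, of n c] c by simp
    have "- f a \<le> - c"
      by (rule a[of "\<lambda>x. - f x" n "- c"]) (use c f in \<open>auto intro: bounded_linear_minus\<close>)
    then show "c \<le> f a" by simp
  qed
  \<comment> \<open>Functionals in \<open>G n\<close> vanish on all \<open>x i\<close> with
    \<open>i \<ge> n\<close>, so they are constant along \<open>s\<close> from \<open>n\<close> on
    and take the same value at \<open>a\<close>.\<close>
  have a_Z: "a - s n \<in> Z n" for n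
    unfolding Z_def common_kernel_def
  proof (intro CollectI ballI)
    fix g assume g: "g \<in> G n"
    then have bl: "bounded_linear g" using good by (auto simp: good_def)
    have "g (s k) = g (s n)" if "k \<ge> n" for k
    proof -
      have "g (\<Sum>i\<in>{n..<k}. x i) = 0"
        using tail_Z[of k x n] x(1) g by (simp add: Z_def common_kernel_def)
      then show ?thesis
        using split[OF that, of x] by (simp add: s_def linear_add[OF bounded_linear.linear[OF bl]])
    qed
    then have "g a = g (s n)" by (rule a_eq[OF bl])
    then show "g (a - s n) = 0" by (simp add: linear_diff[OF bounded_linear.linear[OF bl]])
  qed
  \<comment> \<open>The norm closure of a subspace is weakly closed: a functional separating
    \<open>a\<close> from the span would vanish on every \<open>s k\<close>, hence at
    \<open>a\<close>.\<close>
  have "a \<in> closure (span (range x))"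
  proof (rule ccontr)
    assume "a \<notin> closure (span (range x))"
    then obtain g :: "'a \<Rightarrow> real"
      where g: "bounded_linear g" "\<And>m. m \<in> span (range x) \<Longrightarrow> g m = 0" "g a > 0"
      using separating_functional[OF subspace_span] by blast
    have "s k \<in> span (range x)" for k
      unfolding s_def by (blast intro: span_sum span_base)
    then have "g a = 0" using g(2) by (intro a_eq[OF g(1), of 0]) auto
    then show False using g(3) by simp
  qed
  \<comment> \<open>With the factor 2 of almost orthogonality, 1/4 puts late partial sums within 1/2
    of \<open>t\<close>, so two consecutive ones differ by less than 1.\<close>
  then obtain t where t: "t \<in> span (range x)" "dist t a < 1/4"
    by (meson closure_approachable zero_less_divide_1_iff zero_less_numeral)
  have "span (range x) \<subseteq> (\<Union>n. span (E n))"
  proof (rule span_minimal)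
    show "range x \<subseteq> (\<Union>n. span (E n))"
      using x(1) F_E by (blast intro: span_base)
    show "subspace (\<Union>n. span (E n))"
    proof (rule subspaceI)
      fix u v assume "u \<in> (\<Union>n. span (E n))" "v \<in> (\<Union>n. span (E n))"
      then obtain m n where "u \<in> span (E m)" "v \<in> span (E n)" by blast
      then have "u \<in> span (E (max m n))" "v \<in> span (E (max m n))"
        using span_mono[OF E_mono[of m "max m n"]] span_mono[OF E_mono[of n "max m n"]] by auto
      then show "u + v \<in> (\<Union>n. span (E n))" by (blast intro: span_add)
    qed (use span_zero span_scale in blast)+
  qed
  then obtain n where n: "t \<in> span (E n)" using t(1) by blast
  have close: "norm (s k - t) < 1/2" if kn: "k \<ge> Suc n" for k
  proof -
    obtain j where k: "k = Suc j" "n \<le> j" using kn by (cases k) auto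
    have "t \<in> span (E k)" using n span_mono[OF E_mono[of n k]] kn by auto
    \<comment> \<open>Here \<open>s k - t\<close> lies in \<open>span (E k)\<close> and
      \<open>a - s k\<close> in \<open>Z k\<close>, and their sum is \<open>a - t\<close>.\<close>
    then have "norm (s k - t) \<le> 2 * norm ((s k - t) + (a - s k))"
      using s_E[of k] a_Z[of k] unfolding k by (intro mazur) (auto intro: span_diff)
    then show ?thesis using t(2) by (simp add: dist_norm norm_minus_commute)
  qed
  have "norm (x (Suc n)) \<le> norm (s (Suc (Suc n)) - t) + norm (s (Suc n) - t)"
    using norm_triangle_ineq4[of "s (Suc (Suc n)) - t" "s (Suc n) - t"] by (simp add: s_def)
  also have "\<dots> < 1/2 + 1/2" by (intro add_strict_mono close) auto
  finally show False using F_norm[OF x(1)] by simp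
qed

section \<open>Reduction of complex scalars to real scalars\<close>

text \<open>A real bidual element is extended to complex functionals by acting on real and imaginary
  parts. The point representing the extension also represents the original, since every real
  functional is the real part of a complex one.\<close>

lemma reflexive_scaleR_of_complex:
  fixes scaleC :: "complex \<Rightarrow> 'a::real_normed_vector \<Rightarrow> 'a"
  assumes "normed_space_over scaleC" "normed_space_over.reflexive scaleC"
  shows "normed_space_over.reflexive (scaleR :: real \<Rightarrow> 'a \<Rightarrow> 'a)"
  unfolding normed_space_over.reflexive_def[OF normed_space_over_real] dual_scaleR
proof
  interpret C: normed_space_over scaleC by (rule assms(1))
  fix \<Phi> assume "\<Phi> \<in> normed_space_over.bidual (scaleR :: real \<Rightarrow> 'a \<Rightarrow> 'a)"
  then obtain K where add: "\<And>f g. bounded_linear f \<Longrightarrow> bounded_linear g \<Longrightarrow> \<Phi> (\<lambda>x. f x + g x) = \<Phi> f + \<Phi> g"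
    and scale: "\<And>c f. bounded_linear f \<Longrightarrow> \<Phi> (\<lambda>x. c * f x) = c * \<Phi> f"
    and K: "\<And>f. bounded_linear f \<Longrightarrow> \<bar>\<Phi> f\<bar> \<le> K * onorm f"
    unfolding normed_space_over.bidual_def[OF normed_space_over_real] dual_scaleR by auto
  define \<Psi> where "\<Psi> g = Complex (\<Phi> (\<lambda>x. Re (g x))) (\<Phi> (\<lambda>x. Im (g x)))" for g :: "'a \<Rightarrow> complex"
  have bl: "bounded_linear (\<lambda>x. Re (g x))" "bounded_linear (\<lambda>x. Im (g x))"
    if "g \<in> C.dual" for g
    using that by (auto simp: C.dual_def intro: bounded_linear_Re[THEN bounded_linear_compose]
        bounded_linear_Im[THEN bounded_linear_compose])
  have "\<Psi> \<in> C.bidual"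
    unfolding C.bidual_def mem_Collect_eq
  proof (intro conjI ballI allI exI)
    fix f g assume "f \<in> C.dual" "g \<in> C.dual"
    then show "\<Psi> (\<lambda>x. f x + g x) = \<Psi> f + \<Psi> g"
      by (simp add: \<Psi>_def add bl complex_eq_iff)
  next
    fix c f assume f: "f \<in> C.dual"
    have "\<Phi> (\<lambda>x. Re (c * f x)) = Re c * \<Phi> (\<lambda>x. Re (f x)) - Im c * \<Phi> (\<lambda>x. Im (f x))"
      using add[of "\<lambda>x. Re c * Re (f x)" "\<lambda>x. - Im c * Im (f x)"] scale[OF bl(1)[OF f], of "Re c"]
        scale[OF bl(2)[OF f], of "- Im c"] bl[OF f] by (simp add: bounded_linear_const_mult bounded_linear_minus)
    moreover have "\<Phi> (\<lambda>x. Im (c * f x)) = Re c * \<Phi> (\<lambda>x. Im (f x)) + Im c * \<Phi> (\<lambda>x. Re (f x))"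
      using add[of "\<lambda>x. Re c * Im (f x)" "\<lambda>x. Im c * Re (f x)"] scale[OF bl(2)[OF f], of "Re c"]
        scale[OF bl(1)[OF f], of "Im c"] bl[OF f] by (simp add: bounded_linear_const_mult)
    ultimately show "\<Psi> (\<lambda>x. c * f x) = c * \<Psi> f"
      by (simp add: \<Psi>_def complex_eq_iff)
  next
    fix f assume f: "f \<in> C.dual"
    then have blf: "bounded_linear f" by (simp add: C.dual_def)
    have le: "onorm h \<le> onorm f" if "\<And>x. \<bar>h x\<bar> \<le> norm (f x)" for h :: "'a \<Rightarrow> real"
      by (rule onorm_bound[OF onorm_pos_le[OF blf]]) (metis that onorm[OF blf] order_trans real_norm_def)
    \<comment> \<open>The constant \<open>K\<close> may be negative, so its modulus is taken before
      using monotonicity in the operator norm.\<close>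
    have "\<bar>\<Phi> h\<bar> \<le> \<bar>K\<bar> * onorm f" if h: "bounded_linear h" "\<And>x. \<bar>h x\<bar> \<le> norm (f x)" for h
    proof -
      have "\<bar>\<Phi> h\<bar> \<le> K * onorm h" by (rule K[OF h(1)])
      also have "\<dots> \<le> \<bar>K\<bar> * onorm h"
        by (intro mult_right_mono onorm_pos_le[OF h(1)]) simp
      also have "\<dots> \<le> \<bar>K\<bar> * onorm f"
        by (intro mult_left_mono le h(2)) simp
      finally show ?thesis .
    qed
    then have "\<bar>\<Phi> (\<lambda>x. Re (f x))\<bar> \<le> \<bar>K\<bar> * onorm f" "\<bar>\<Phi> (\<lambda>x. Im (f x))\<bar> \<le> \<bar>K\<bar> * onorm f"
      using bl[OF f] abs_Re_le_cmod abs_Im_le_cmod by auto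
    then show "norm (\<Psi> f) \<le> (2 * \<bar>K\<bar>) * onorm f"
      using cmod_le[of "\<Psi> f"] by (simp add: \<Psi>_def)
  qed
  then obtain x where x: "\<And>g. g \<in> C.dual \<Longrightarrow> \<Psi> g = g x"
    using assms(2) unfolding C.reflexive_def by blast
  have "\<Phi> f = f x" if f: "bounded_linear f" for f
  proof -
    \<comment> \<open>Complex linearity dictates the imaginary part: \<open>Im (g y)\<close> must
      equal \<open>- Re (g (scaleC \<i> y))\<close>.\<close>
    define g where "g y = Complex (f y) (- f (scaleC \<i> y))" for y
    have lin: "linear f" using f by (rule bounded_linear.linear)
    have cplx: "scaleC c y = Re c *\<^sub>R y + Im c *\<^sub>R scaleC \<i> y" for c y
    proof -
      have "scaleC c y = scaleC (of_real (Re c) + of_real (Im c) * \<i>) y"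
        by (simp add: complex_eq_iff)
      then show ?thesis
        by (simp only: C.scale_left_distrib C.scale_scale[symmetric] C.scale_of_real)
    qed
    have ii: "scaleC \<i> (scaleC \<i> y) = - y" for y by simp
    have i_real: "scaleC \<i> (r *\<^sub>R y) = r *\<^sub>R scaleC \<i> y" for r y
      by (metis C.scale_of_real C.scale_left_commute)
    have g_add: "g (u + v) = g u + g v" for u v
      by (simp add: g_def complex_eq_iff linear_add[OF lin] C.scale_right_distrib)
    have g_scale: "g (scaleC c y) = c * g y" for c y
      by (simp add: g_def complex_eq_iff cplx[of c y] linear_add[OF lin] linear_scale[OF lin]
          linear_neg[OF lin] linear_diff[OF lin] C.scale_right_distrib i_real ii algebra_simps del: C.scale_scale)
    have "bounded_linear g"
    proof (rule bounded_linear_intro)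
      show "g (r *\<^sub>R y) = r *\<^sub>R g y" for r y
        using g_scale[of "of_real r" y] by (simp add: C.scale_of_real scaleR_conv_of_real)
      fix y
      have "norm (g y) \<le> \<bar>f y\<bar> + \<bar>f (scaleC \<i> y)\<bar>"
        using cmod_le[of "g y"] by (simp add: g_def)
      also have "\<dots> \<le> onorm f * norm y + onorm f * norm (scaleC \<i> y)"
        using onorm[OF f, of y] onorm[OF f, of "scaleC \<i> y"] by simp
      finally show "norm (g y) \<le> norm y * (2 * onorm f)" by (simp add: C.norm_scale algebra_simps)
    qed (rule g_add)
    moreover have "Vector_Spaces.linear scaleC (*) g"
      by unfold_locales (simp_all add: g_add g_scale algebra_simps)
    ultimately have "g \<in> C.dual"
      by (simp add: C.dual_def)
    then have "\<Psi> g = g x" by (rule x)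
    \<comment> \<open>Only the real parts of both sides are compared.\<close>
    then show ?thesis by (simp add: \<Psi>_def g_def)
  qed
  then show "\<exists>x. \<forall>f\<in>{f. bounded_linear f}. \<Phi> f = f x" by blast
qed

text \<open>A complex span is also a real subspace, so a finite set spanning over the reals would
  span over the complex numbers.\<close>

lemma infinite_dimensional_scaleR_of_complex:
  fixes scaleC :: "complex \<Rightarrow> 'a::real_normed_vector \<Rightarrow> 'a"
  assumes "normed_space_over scaleC" "normed_space_over.infinite_dimensional scaleC"
  shows "normed_space_over.infinite_dimensional (scaleR :: real \<Rightarrow> 'a \<Rightarrow> 'a)"
proof -
  interpret C: normed_space_over scaleC by (rule assms(1))
  have "span B \<subseteq> C.span B" for B :: "'a set"
  proof (rule span_minimal)
    show "subspace (C.span B)"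
      by (rule subspaceI)
         (auto intro: C.span_zero C.span_add C.span_scale simp flip: C.scale_of_real)
  qed (rule C.span_superset)
  then show ?thesis
    using assms(2) unfolding infinite_dimensional_scaleR C.infinite_dimensional_def by blast
qed

theorem corollary1p2:
  fixes scaleC :: "complex \<Rightarrow> 'a::banach \<Rightarrow> 'a"
  shows
    "(normed_space_over.infinite_dimensional (scaleR :: real \<Rightarrow> 'a \<Rightarrow> 'a) \<and>
      normed_space_over.reflexive (scaleR :: real \<Rightarrow> 'a \<Rightarrow> 'a) \<longrightarrow>
      (\<exists>\<epsilon>>0. \<exists>x :: nat \<Rightarrow> 'a. range x \<subseteq> sphere 0 1 \<and> symmetrically_separated (1 + \<epsilon>) x)) \<and>
     (normed_space_over scaleC \<and>
      normed_space_over.infinite_dimensional scaleC \<and>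
      normed_space_over.reflexive scaleC \<longrightarrow>
      (\<exists>\<epsilon>>0. \<exists>x :: nat \<Rightarrow> 'a. range x \<subseteq> sphere 0 1 \<and> symmetrically_separated (1 + \<epsilon>) x))"
  \<comment> \<open>Sphere and separation depend only on norm and addition, so the complex case is
    the real one for the same space.\<close>
  using separated_sequence_real infinite_dimensional_scaleR_of_complex reflexive_scaleR_of_complex
  by blast

end
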